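(* Let $a,b,c,d,\tau,\eta\in\mathbb{R}$ with $ad-bc=1$ and $b>0$, and let $O_A$ be the offset linear canonical transform with parameter $A=\left[\begin{array}{cc|c} a & b & \tau\\ c & d & \eta\end{array}\right]$. If a function $f\in L^2(\mathbb{R})$ is such that $$|f(t)|=\mathcal{O}\big(e^{-\pi\alpha t^2}\big)\quad\text{and}\quad |O_Af(u)|=\mathcal{O}\big(e^{-u^2/(4\pi\alpha b^2)}\big)$$ for some positive constant $\alpha>0$, then $$f(t)=Ce^{-\left(\pi\alpha+j\frac{a}{2b}\right)t^2-j\frac{1}{b}t\tau}$$ for some $C\in\mathbb{C}$.
   Context: Here $j$ denotes the imaginary unit. For real parameters $a,b,c,d,\tau,\eta$ with $ad-bc=1$ and $b>0$, the offset linear canonical transform (OLCT) of a function $f$ on $\mathbb{R}$ is $$O_Af(u)=\int_{-\infty}^{+\infty}f(t)K_A(t,u)\,\mathrm{d}t,\qquad K_A(t,u)=\frac{1}{\sqrt{j2\pi b}}\,e^{j\frac{a}{2b}t^2-j\frac{1}{b}t(u-\tau)-j\frac{1}{b}u(d\tau-b\eta)+j\frac{d}{2b}(u^2+\tau^2)}.$$ For $f\in L^2(\mathbb{R})$ the integral is understood in the usual $L^2$ sense, as for the Fourier transform on $L^2(\mathbb{R})$. Functions in $L^2(\mathbb{R})$ are identified when equal almost everywhere. *)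

theory Defs
  imports "HOL-Analysis.Analysis" "HOL-Library.Landau_Symbols"
begin

text \<open>Elements of \<open>L\<^sup>2(\<real>)\<close> are represented by functions; identification almost everywhere is made
  explicit where it matters.\<close>

definition L2 :: "(real \<Rightarrow> complex) set" where
  "L2 = {f \<in> borel_measurable lebesgue. integrable lebesgue (\<lambda>t. (cmod (f t))\<^sup>2)}"

text \<open>The square root of \<open>j2\<pi>b\<close> is the principal one. The kernel does not involve \<open>c\<close>, which is
  listed only to keep the full parameter matrix.\<close>

definition olct_kernel ::
  "real \<Rightarrow> real \<Rightarrow> real \<Rightarrow> real \<Rightarrow> real \<Rightarrow> real \<Rightarrow> real \<Rightarrow> real \<Rightarrow> complex" where
  "olct_kernel a b c d \<tau> \<eta> t u =
     1 / csqrt (\<i> * complex_of_real (2 * pi * b)) *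
     exp (\<i> * complex_of_real (a / (2 * b) * t\<^sup>2)
          - \<i> * complex_of_real (1 / b * t * (u - \<tau>))
          - \<i> * complex_of_real (1 / b * u * (d * \<tau> - b * \<eta>))
          + \<i> * complex_of_real (d / (2 * b) * (u\<^sup>2 + \<tau>\<^sup>2)))"

text \<open>\<open>has_olct a b c d \<tau> \<eta> f F\<close>: \<open>F\<close> is a representative of the transform of \<open>f \<in> L\<^sup>2(\<real>)\<close>, that is,
  \<open>F\<close> is the limit in \<open>L\<^sup>2(\<real>)\<close> of the integrals over \<open>[-R, R]\<close> as \<open>R\<close> tends to infinity, as in
  Plancherel's definition of the Fourier transform. The distance is a nonnegative extended integral
  because the Bochner integral of a non-integrable function would be \<open>0\<close>.\<close>

definition has_olct ::
  "real \<Rightarrow> real \<Rightarrow> real \<Rightarrow> real \<Rightarrow> real \<Rightarrow> real \<Rightarrow> (real \<Rightarrow> complex) \<Rightarrow> (real \<Rightarrow> complex) \<Rightarrow> bool" where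
  "has_olct a b c d \<tau> \<eta> f F \<longleftrightarrow> f \<in> L2 \<and> F \<in> L2 \<and>
     ((\<lambda>R. \<integral>\<^sup>+ u. ennreal ((cmod (F u -
              (LINT t:{-R..R}|lebesgue. f t * olct_kernel a b c d \<tau> \<eta> t u)))\<^sup>2) \<partial>lebesgue)
        \<longlongrightarrow> 0) at_top"

text \<open>The relation \<open>|f(t)| = O(g(t))\<close> as \<open>|t|\<close> tends to infinity, for a class of functions modulo
  equality almost everywhere: it holds for some representative.\<close>

definition ae_bigo :: "(real \<Rightarrow> complex) \<Rightarrow> (real \<Rightarrow> real) \<Rightarrow> bool" where
  "ae_bigo f g \<longleftrightarrow>
     (\<exists>h. (AE t in lebesgue. h t = f t) \<and> (\<lambda>t. cmod (h t)) \<in> O[at_infinity](g))"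

end

theory Submission
  imports Defs "HOL-Complex_Analysis.Complex_Analysis" "HOL-Probability.Probability"
begin

text \<open>After multiplication of \<open>f\<close> by a unimodular chirp, the transform becomes, up to a factor of
  constant modulus, the Fourier integral of the resulting function \<open>g\<close> at \<open>u / b\<close>, and the claim is Hardy's
  uncertainty principle for \<open>g\<close> with \<open>s = \<pi>\<alpha>\<close>. The Gaussian decay of \<open>g\<close> makes its Fourier integral \<open>G\<close>
  entire with \<open>|G(x + iy)| \<le> A exp (y\<^sup>2 / 4s)\<close>, so \<open>H(z) = G(z) exp (z\<^sup>2 / 4s)\<close> satisfies
  \<open>|H(z)| \<le> A exp ((Re z)\<^sup>2 / 4s)\<close> and is bounded on both axes. As the growth has order 2,
  Phragmen-Lindelof fails on a quadrant but holds on every smaller sector; a limit of sectors still gives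
  that \<open>H\<close> is bounded, hence constant. So \<open>G\<close> is a Gaussian, and so is \<open>g\<close> by uniqueness of Fourier
  transforms.\<close>

section \<open>Entire functions of Gaussian growth\<close>

text \<open>Taking \<open>exp (\<beta> * X)\<close> out of the exponent leaves a bracket that tends
  to \<open>- c\<close>, because \<kappa> < \<beta>. In the Phragmen-Lindelof argument this makes
  the damping factor win on the vertical sides of a wide rectangle.\<close>

lemma exp_minus_exp_tendsto_0:
  fixes A B c \<kappa> \<beta> :: real
  assumes "c > 0" "\<kappa> < \<beta>" "\<beta> > 0"
  shows "((\<lambda>X. A * exp (B * exp (\<kappa> * X) - c * exp (\<beta> * X))) \<longlongrightarrow> 0) at_top"
proof -
  have 1: "((\<lambda>X. B * exp ((\<kappa> - \<beta>) * X) - c) \<longlongrightarrow> B * 0 - c) at_top"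
  proof (intro tendsto_intros filterlim_compose[OF exp_at_bot])
    show "filterlim (\<lambda>X. (\<kappa> - \<beta>) * X) at_bot at_top"
      using assms by (intro filterlim_tendsto_neg_mult_at_bot[OF tendsto_const]) (auto simp: filterlim_ident)
  qed
  have 2: "filterlim (\<lambda>X. exp (\<beta> * X)) at_top at_top"
    using assms by (intro filterlim_compose[OF exp_at_top] filterlim_tendsto_pos_mult_at_top[OF tendsto_const])
       (auto simp: filterlim_ident)
  have "filterlim (\<lambda>X. (B * exp ((\<kappa> - \<beta>) * X) - c) * exp (\<beta> * X)) at_bot at_top"
    using assms by (intro filterlim_tendsto_neg_mult_at_bot[OF 1] 2) auto
  also have "(\<lambda>X. (B * exp ((\<kappa> - \<beta>) * X) - c) * exp (\<beta> * X)) = (\<lambda>X. B * exp (\<kappa> * X) - c * exp (\<beta> * X))"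
    by (auto simp: algebra_simps simp flip: exp_add)
  finally show ?thesis
    by (intro tendsto_mult_right_zero filterlim_compose[OF exp_at_bot])
qed

text \<open>The function is damped by an exponential of \<open>- \<epsilon>\<close> times a
  hyperbolic cosine of rate \<beta>, where \<kappa> < \<beta> < \<open>pi / (2 * h)\<close>. The
  lower bound on \<beta> beats the growth, the upper bound keeps the cosine in \<open>S\<close>
  positive on the closed strip. The maximum modulus principle on a large rectangle gives the bound
  up to the damping factor, which disappears as \<epsilon> tends to 0.\<close>

theorem phragmen_lindelof_strip:
  fixes k :: "complex \<Rightarrow> complex"
  assumes hol: "k holomorphic_on {w. \<bar>Im w\<bar> < h}"
    and cont: "continuous_on {w. \<bar>Im w\<bar> \<le> h} k"
    and "0 < h" "0 \<le> \<kappa>" "\<kappa> * h < pi / 2" "0 < M"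
    and growth: "\<And>w. \<bar>Im w\<bar> \<le> h \<Longrightarrow> norm (k w) \<le> A * exp (B * exp (\<kappa> * \<bar>Re w\<bar>))"
    and boundary: "\<And>w. \<bar>Im w\<bar> = h \<Longrightarrow> norm (k w) \<le> M"
    and w: "\<bar>Im w\<bar> \<le> h"
  shows "norm (k w) \<le> M"
proof -
  have "\<kappa> < pi / (2 * h)"
    using assms by (simp add: field_simps)
  then obtain \<beta> where \<beta>: "\<kappa> < \<beta>" "\<beta> < pi / (2 * h)"
    using dense by blast
  have \<beta>0: "\<beta> > 0" and \<beta>h: "\<beta> * h < pi / 2"
    using \<beta> \<open>0 \<le> \<kappa>\<close> \<open>0 < h\<close> by (auto simp: field_simps)
  \<comment> \<open>\<open>S z\<close> is the real part of
    \<open>exp (\<beta> * z) + exp (- (\<beta> * z))\<close>, so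
    \<open>exp (- \<epsilon> * S z)\<close> is the modulus of the damping factor.\<close>
  define S where "S z = (exp (\<beta> * Re z) + exp (- (\<beta> * Re z))) * cos (\<beta> * Im z)" for z
  have cos_ge: "cos (\<beta> * h) \<le> cos (\<beta> * Im z)" if "\<bar>Im z\<bar> \<le> h" for z
  proof -
    have "\<beta> * h \<le> pi" using \<beta>h pi_gt_zero by linarith
    then have "cos (\<beta> * h) \<le> cos \<bar>\<beta> * Im z\<bar>"
      using that \<beta>0 by (intro cos_monotone_0_pi_le) (auto simp: abs_mult intro: less_imp_le)
    then show ?thesis by simp
  qed
  have \<delta>: "cos (\<beta> * h) > 0"
    using \<beta>h \<beta>0 \<open>0 < h\<close> by (intro cos_gt_zero_pi) (auto intro: less_trans[of _ 0])
  have S_ge: "exp (\<beta> * \<bar>Re z\<bar>) * cos (\<beta> * h) \<le> S z" if "\<bar>Im z\<bar> \<le> h" for z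
    unfolding S_def using cos_ge[OF that] \<delta>
    by (intro mult_mono) (auto simp: abs_if)
  have main: "norm (k w) * exp (- \<epsilon> * S w) \<le> M" if \<epsilon>: "\<epsilon> > 0" for \<epsilon> :: real
  proof -
    define g where "g z = k z * exp (- of_real \<epsilon> * (exp (of_real \<beta> * z) + exp (- (of_real \<beta> * z))))" for z
    have norm_g: "norm (g z) = norm (k z) * exp (- \<epsilon> * S z)" for z
      by (simp add: g_def norm_mult norm_exp_eq_Re Re_exp S_def algebra_simps)
    have "eventually (\<lambda>X. A * exp (B * exp (\<kappa> * X) - (\<epsilon> * cos (\<beta> * h)) * exp (\<beta> * X)) < M) at_top"
      using \<epsilon> \<delta> \<beta> \<beta>0 \<open>0 < M\<close> by (intro order_tendstoD(2)[OF exp_minus_exp_tendsto_0]) auto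
    then have "eventually (\<lambda>X. A * exp (B * exp (\<kappa> * X) - (\<epsilon> * cos (\<beta> * h)) * exp (\<beta> * X)) < M \<and> X > \<bar>Re w\<bar>) at_top"
      by (intro eventually_conj eventually_gt_at_top)
    \<comment> \<open>The half-width \<open>X\<close> is so large that the damped growth bound on
      the vertical sides is below \<open>M\<close> and that the rectangle contains
      \<open>w\<close>.\<close>
    then obtain X where X: "A * exp (B * exp (\<kappa> * X) - (\<epsilon> * cos (\<beta> * h)) * exp (\<beta> * X)) < M" "X > \<bar>Re w\<bar>"
      by (auto dest: eventually_happens)
    let ?R = "cbox (Complex (-X) (-h)) (Complex X h)"
    have "norm (g w) \<le> M"
    proof (rule maximum_modulus_frontier[of g ?R])
      show "w \<in> ?R"
        using X w by (auto simp: in_cbox_complex_iff)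
      show "bounded ?R" by simp
      have *: "exp (- \<epsilon> * S z) \<le> 1" if "\<bar>Im z\<bar> \<le> h" for z
      proof -
        have "0 \<le> S z" using S_ge[OF that] \<delta> 
          by (smt (verit) exp_gt_zero mult_pos_pos)
        then show ?thesis using \<epsilon> by simp
      qed
      show "g holomorphic_on interior ?R"
        unfolding g_def using hol
        by (auto intro!: holomorphic_intros elim!: holomorphic_on_subset simp: in_box_complex_iff)
      show "continuous_on (closure ?R) g"
        unfolding g_def using cont
        by (auto intro!: continuous_intros elim!: continuous_on_subset simp: in_cbox_complex_iff)
      show "norm (g z) \<le> M" if z: "z \<in> frontier ?R" for z
      proof -
        have z1: "\<bar>Im z\<bar> \<le> h" and z2: "\<bar>Im z\<bar> = h \<or> \<bar>Re z\<bar> = X"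
          using z by (auto simp: frontier_cbox in_cbox_complex_iff in_box_complex_iff)
        from z2 show ?thesis
        proof
          assume "\<bar>Im z\<bar> = h"
          then show ?thesis
            unfolding norm_g using *[OF z1] boundary[of z] \<open>0 < M\<close> mult_mono[of "norm (k z)" M "exp (- \<epsilon> * S z)" 1] by simp
        next
          assume X': "\<bar>Re z\<bar> = X"
          have "norm (g z) \<le> (A * exp (B * exp (\<kappa> * X))) * exp (- ((\<epsilon> * cos (\<beta> * h)) * exp (\<beta> * X)))"
            unfolding norm_g 
          proof (rule mult_mono)
            show "norm (k z) \<le> A * exp (B * exp (\<kappa> * X))"
              using growth[OF z1] X' by simp
            show "exp (- \<epsilon> * S z) \<le> exp (- (\<epsilon> * cos (\<beta> * h) * exp (\<beta> * X)))"
              using S_ge[OF z1] X' \<epsilon> by (simp add: mult.assoc mult.commute)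
            then show "0 \<le> A * exp (B * exp (\<kappa> * X))"
              using growth[OF z1] X' norm_ge_zero[of "k z"] by (metis order_trans)
          qed auto
          also have "\<dots> = A * exp (B * exp (\<kappa> * X) - (\<epsilon> * cos (\<beta> * h)) * exp (\<beta> * X))"
            by (simp add: exp_diff exp_minus field_simps)
          finally show ?thesis using X by linarith
        qed
      qed
    qed
    then show ?thesis by (simp add: norm_g)
  qed
  have "((\<lambda>\<epsilon>. norm (k w) * exp (- \<epsilon> * S w)) \<longlongrightarrow> norm (k w) * exp (- 0 * S w)) (at_right 0)"
    by (intro tendsto_intros)
  moreover have "eventually (\<lambda>\<epsilon>. norm (k w) * exp (- \<epsilon> * S w) \<le> M) (at_right 0)"
    using main by (auto simp: eventually_at_filter)
  ultimately have "norm (k w) * exp (- 0 * S w) \<le> M"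
    by (rule tendsto_upperbound) simp
  then show ?thesis by simp
qed

text \<open>On the sector between the real axis and the ray of angle \<open>\<phi> < \<pi>/2\<close>, passed to a strip by \<open>exp\<close>,
  the factor \<open>exp (i q z\<^sup>2)\<close> has modulus 1 on the real axis, and \<open>q\<close> is chosen such that it compensates the
  growth of \<open>H\<close> on the other ray. As \<open>\<phi>\<close> tends to \<open>\<pi>/2\<close>, \<open>q\<close> tends to 0.\<close>

lemma holomorphic_bounded_first_quadrant:
  fixes H :: "complex \<Rightarrow> complex"
  assumes hol: "H holomorphic_on UNIV" and "0 \<le> c" "0 < N"
    and growth: "\<And>z. norm (H z) \<le> N * exp (c * (Re z)\<^sup>2)"
    and real: "\<And>x. norm (H (of_real x)) \<le> N"
    and z: "Re z > 0" "Im z > 0"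
  shows "norm (H z) \<le> N"
proof -
  have z0: "z \<noteq> 0" using z by auto
  have argz: "0 < Arg z" "Arg z < pi / 2"
    using z z0 Arg_lt_pi[of z] Re_Ln_pos_lt_imp[of z] Arg_eq_Im_Ln[OF z0]
    by (auto simp: Im_Ln_pos_lt_imp)
  have main: "norm (H z) * exp (- (c * cos \<phi> / sin \<phi>) * (Re z * Im z)) \<le> N" if \<phi>: "Arg z < \<phi>" "\<phi> < pi / 2" for \<phi>
  proof -
    define q where "q = c * cos \<phi> / (2 * sin \<phi>)"
    have sc: "sin \<phi> > 0" "cos \<phi> > 0"
      using \<phi> argz by (auto intro!: sin_gt_zero cos_gt_zero)
    have q0: "q \<ge> 0" using sc \<open>0 \<le> c\<close> by (simp add: q_def)
    \<comment> \<open>This maps the strip of half-width \<open>\<phi> / 2\<close> to the sector of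
      arguments between 0 and \<phi>; the shift by \<open>\<phi> / 2\<close> makes the strip
      symmetric about the real axis.\<close>
    define e where "e w = exp (w + \<i> * of_real (\<phi> / 2))" for w
    define k where "k w = H (e w) * exp (\<i> * of_real q * (e w)\<^sup>2)" for w
    have norm_k: "norm (k w) = norm (H (e w)) * exp (- (2 * q) * (Re (e w) * Im (e w)))" for w
      by (simp add: k_def norm_mult norm_exp_eq_Re power2_eq_square algebra_simps)
    have Re_e: "Re (e w) = exp (Re w) * cos (Im w + \<phi> / 2)" 
     and Im_e: "Im (e w) = exp (Re w) * sin (Im w + \<phi> / 2)" for w
      by (simp_all add: e_def Re_exp Im_exp)
    have sc_ge: "0 \<le> sin (Im w + \<phi> / 2)" "0 \<le> cos (Im w + \<phi> / 2)" if "\<bar>Im w\<bar> \<le> \<phi> / 2" for w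
      using that \<phi> argz pi_gt_zero by (auto intro!: sin_ge_zero cos_ge_zero simp: abs_le_iff)
    have "norm (k (Ln z - \<i> * of_real (\<phi> / 2))) \<le> N"
    \<comment> \<open>The modulus of \<open>e w\<close> is \<open>exp (Re w)\<close>, so growth of
      order 2 becomes the rate \<kappa> = 2. The condition \<open>\<kappa> * h < pi / 2\<close> then
      reads \<phi> < \<open>pi / 2\<close>, which is why the sector has to be smaller than the
      quadrant.\<close>
    proof (rule phragmen_lindelof_strip[of k "\<phi> / 2" 2 N N c])
      have "e holomorphic_on UNIV"
        unfolding e_def by (intro holomorphic_intros)
      then have "k holomorphic_on UNIV"
        unfolding k_def using holomorphic_on_compose_gen[of e UNIV H UNIV] hol
        by (intro holomorphic_intros) (auto simp: o_def)
      then show "k holomorphic_on {w. \<bar>Im w\<bar> < \<phi> / 2}" "continuous_on {w. \<bar>Im w\<bar> \<le> \<phi> / 2} k"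
        by (auto intro: holomorphic_on_subset holomorphic_on_imp_continuous_on)
      show "norm (k w) \<le> N * exp (c * exp (2 * \<bar>Re w\<bar>))" if "\<bar>Im w\<bar> \<le> \<phi> / 2" for w
      proof -
        have "(Re (e w))\<^sup>2 \<le> exp (2 * \<bar>Re w\<bar>)"
        proof -
          have "(Re (e w))\<^sup>2 = exp (2 * Re w) * (cos (Im w + \<phi> / 2))\<^sup>2"
            by (simp add: Re_e power_mult_distrib exp_double)
          also have "\<dots> \<le> exp (2 * \<bar>Re w\<bar>) * 1"
            by (intro mult_mono) (auto simp: abs_square_le_1)
          finally show ?thesis by simp
        qed
        then have "c * (Re (e w))\<^sup>2 \<le> c * exp (2 * \<bar>Re w\<bar>)"
          using \<open>0 \<le> c\<close> by (rule mult_left_mono)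
        then have 1: "norm (H (e w)) \<le> N * exp (c * exp (2 * \<bar>Re w\<bar>))"
          using growth[of "e w"] \<open>0 < N\<close>
          by (meson exp_le_cancel_iff mult_le_cancel_left_pos order_trans)
        have "0 \<le> Re (e w) * Im (e w)"
          using sc_ge[OF that] by (simp add: Re_e Im_e)
        then have 2: "exp (- (2 * q) * (Re (e w) * Im (e w))) \<le> 1"
          using q0 by simp
        show ?thesis
          unfolding norm_k using mult_mono[OF 1 2] \<open>0 < N\<close> by simp
      qed
      show "norm (k w) \<le> N" if w: "\<bar>Im w\<bar> = \<phi> / 2" for w
      proof (cases "Im w = - (\<phi> / 2)")
        case True
        then have "e w = of_real (exp (Re w))" 
          by (intro complex_eqI) (simp_all add: Re_e Im_e)
        then show ?thesis
          using real[of "exp (Re w)"] by (simp add: norm_k)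
      next
        case False
        then have Imw: "Im w = \<phi> / 2" using w by (auto simp: abs_if split: if_splits)
        have "norm (k w) \<le> (N * exp (c * (Re (e w))\<^sup>2)) * exp (- (2 * q) * (Re (e w) * Im (e w)))"
          unfolding norm_k by (intro mult_right_mono growth) auto
        also have "\<dots> = N * exp (c * (Re (e w))\<^sup>2 - (2 * q) * (Re (e w) * Im (e w)))"
          by (simp add: exp_diff exp_minus field_simps)
        \<comment> \<open>On the upper ray both terms are multiples of
          \<open>exp (2 * Re w)\<close>, with coefficients \<open>c * (cos \<phi>)\<^sup>2\<close>
          and \<open>2 * q * cos \<phi> * sin \<phi>\<close>; these agree by the choice of
          \<open>q\<close>.\<close>
        also have "c * (Re (e w))\<^sup>2 - (2 * q) * (Re (e w) * Im (e w)) = 0"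
          using sc by (simp add: Re_e Im_e Imw q_def power2_eq_square field_simps)
        finally show ?thesis by simp
      qed
      show "\<bar>Im (Ln z - \<i> * of_real (\<phi> / 2))\<bar> \<le> \<phi> / 2"
      proof -
        have "Im (Ln z - \<i> * of_real (\<phi> / 2)) = Arg z - \<phi> / 2"
          using Arg_eq_Im_Ln[OF z0] by simp
        then show ?thesis using \<phi> argz by linarith
      qed
    qed (use \<phi> argz \<open>0 < N\<close> in auto)
    moreover have "e (Ln z - \<i> * of_real (\<phi> / 2)) = z"
      using z0 by (simp add: e_def)
    ultimately show ?thesis
      by (simp add: norm_k q_def)
  qed
  have "((\<lambda>\<phi>. norm (H z) * exp (- (c * cos \<phi> / sin \<phi>) * (Re z * Im z))) \<longlongrightarrow>
         norm (H z) * exp (- (c * cos (pi/2) / sin (pi/2)) * (Re z * Im z))) (at_left (pi/2))"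
    by (intro tendsto_intros) auto
  moreover have "eventually (\<lambda>\<phi>. norm (H z) * exp (- (c * cos \<phi> / sin \<phi>) * (Re z * Im z)) \<le> N) (at_left (pi/2))"
    using eventually_at_left_real[OF argz(2)] by eventually_elim (use main in auto)
  ultimately have "norm (H z) * exp (- (c * cos (pi/2) / sin (pi/2)) * (Re z * Im z)) \<le> N"
    by (rule tendsto_upperbound) simp
  then show ?thesis by simp
qed

text \<open>The growth bound is even in \<open>Re z\<close> and independent of \<open>Im z\<close>,
  so conjugation and negation carry the other open quadrants to the first one. On the imaginary axis
  the growth bound is already a constant. Liouville's theorem then applies.\<close>

lemma holomorphic_gauss_growth_constant:
  fixes H :: "complex \<Rightarrow> complex"
  assumes hol: "H holomorphic_on UNIV" and "0 \<le> c"
    and growth: "\<And>z. norm (H z) \<le> A * exp (c * (Re z)\<^sup>2)"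
    and real: "\<And>x. norm (H (of_real x)) \<le> M"
  obtains C where "\<And>z. H z = C"
proof -
  \<comment> \<open>The quadrant lemma uses a single positive constant for both bounds; the 1
    secures positivity.\<close>
  define N where "N = max (max A M) 1"
  have N: "N > 0" "A \<le> N" "M \<le> N" by (auto simp: N_def)
  have gr: "norm (H z) \<le> N * exp (c * (Re z)\<^sup>2)" for z
    using growth[of z] N(2) by (meson exp_ge_zero mult_right_mono order_trans)
  have re: "norm (H (of_real x)) \<le> N" for x
    using real[of x] N(3) by linarith
  \<comment> \<open>Stated for an arbitrary \<open>H\<close>, as is \<open>half\<close>, in order to
    be applied to \<open>cnj \<circ> H \<circ> cnj\<close> and \<open>H \<circ> uminus\<close> as
    well.\<close>
  have Q: "norm (H z) \<le> N" if "Im z > 0" "Re z > 0" "H holomorphic_on UNIV" 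
     "\<And>z. norm (H z) \<le> N * exp (c * (Re z)\<^sup>2)" "\<And>x. norm (H (of_real x)) \<le> N" for z and H :: "complex \<Rightarrow> complex"
    using holomorphic_bounded_first_quadrant[OF that(3) \<open>0 \<le> c\<close> N(1) that(4,5,2,1)] .
  have half: "norm (H z) \<le> N" if "Re z > 0" "Im z \<noteq> 0" "H holomorphic_on UNIV" 
     "\<And>z. norm (H z) \<le> N * exp (c * (Re z)\<^sup>2)" "\<And>x. norm (H (of_real x)) \<le> N" for z and H :: "complex \<Rightarrow> complex"
  proof (cases "Im z > 0")
    case True
    then show ?thesis using Q that by blast
  next
    case False
    have "norm ((cnj \<circ> H \<circ> cnj) (cnj z)) \<le> N"
    proof (rule Q[where H = "cnj \<circ> H \<circ> cnj"])
      show "(cnj \<circ> H \<circ> cnj) holomorphic_on UNIV"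
        using that(3) by (intro holomorphic_on_compose_cnj_cnj) (auto elim: holomorphic_on_subset)
      show "norm ((cnj \<circ> H \<circ> cnj) z) \<le> N * exp (c * (Re z)\<^sup>2)" for z
        using that(4)[of "cnj z"] by simp
      show "norm ((cnj \<circ> H \<circ> cnj) (of_real x)) \<le> N" for x
        using that(5)[of x] by simp
    qed (use False that in auto)
    then show ?thesis by simp
  qed
  have "norm (H z) \<le> N" for z
  proof -
    consider "Im z = 0" | "Re z = 0" | "Re z > 0" "Im z \<noteq> 0" | "Re z < 0" "Im z \<noteq> 0" by linarith
    then show ?thesis
    proof cases
      case 1
      then have "z = of_real (Re z)" by (simp add: complex_eq_iff)
      then show ?thesis using re by metis
    next
      case 2
      then show ?thesis using gr[of z] by simp
    next
      case 3
      then show ?thesis using half hol gr re by blast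
    next
      case 4
      have "norm ((H \<circ> uminus) (- z)) \<le> N"
      proof (rule half[where H = "H \<circ> uminus"])
        show "(H \<circ> uminus) holomorphic_on UNIV"
          using hol by (intro holomorphic_on_compose holomorphic_intros) (auto elim: holomorphic_on_subset)
        show "norm ((H \<circ> uminus) z) \<le> N * exp (c * (Re z)\<^sup>2)" for z
          using gr[of "-z"] by simp
        show "norm ((H \<circ> uminus) (of_real x)) \<le> N" for x
          using re[of "-x"] by simp
      qed (use 4 in auto)
      then show ?thesis by simp
    qed
  qed
  then have "bounded (range H)"
    by (auto simp: bounded_iff)
  then have "H constant_on UNIV"
    by (rule Liouville_theorem[OF hol])
  then show ?thesis using that by (auto simp: constant_on_def)
qed

section \<open>Fourier integrals\<close>

text \<open>The frequency is complex so that the transform can be treated as an entire function;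
  there is no normalising factor. Where the integrand is not integrable, the Bochner integral has
  the default value 0.\<close>

definition fourier_integral :: "(real \<Rightarrow> complex) \<Rightarrow> complex \<Rightarrow> complex" where
  "fourier_integral g z = (LINT t|lborel. g t * exp (- (\<i> * z * of_real t)))"

lemma integrable_times_exp:
  fixes g :: "real \<Rightarrow> complex"
  assumes [measurable]: "g \<in> borel_measurable borel"
    and int: "integrable lborel (\<lambda>t. norm (g t) * exp (\<bar>Im z\<bar> * \<bar>t\<bar>))"
  shows "integrable lborel (\<lambda>t. g t * exp (- (\<i> * z * of_real t)))"
proof (rule Bochner_Integration.integrable_bound[OF int])
  have "Im z * t \<le> \<bar>Im z\<bar> * \<bar>t\<bar>" for t
    by (metis abs_ge_self abs_mult)
  then show "AE t in lborel. norm (g t * exp (- (\<i> * z * of_real t))) \<le> norm (norm (g t) * exp (\<bar>Im z\<bar> * \<bar>t\<bar>))"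
    by (intro AE_I2) (auto simp: norm_mult norm_exp_eq_Re intro!: mult_left_mono)
qed auto

lemma norm_fourier_integral_le:
  fixes g :: "real \<Rightarrow> complex"
  assumes [measurable]: "g \<in> borel_measurable borel"
    and int: "integrable lborel (\<lambda>t. norm (g t) * exp (\<bar>Im z\<bar> * \<bar>t\<bar>))"
  shows "norm (fourier_integral g z) \<le> (LINT t|lborel. norm (g t) * exp (\<bar>Im z\<bar> * \<bar>t\<bar>))"
proof -
  have "Im z * t \<le> \<bar>Im z\<bar> * \<bar>t\<bar>" for t
    by (metis abs_ge_self abs_mult)
  then have "norm (g t * exp (- (\<i> * z * of_real t))) \<le> norm (g t) * exp (\<bar>Im z\<bar> * \<bar>t\<bar>)" for t
    by (auto simp: norm_mult norm_exp_eq_Re intro!: mult_left_mono)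
  then have "(LINT t|lborel. norm (g t * exp (- (\<i> * z * of_real t)))) \<le> (LINT t|lborel. norm (g t) * exp (\<bar>Im z\<bar> * \<bar>t\<bar>))"
    by (intro integral_mono integrable_norm integrable_times_exp int) auto
  then show ?thesis
    unfolding fourier_integral_def by (rule order_trans[OF Bochner_Integration.integral_norm_bound])
qed

text \<open>The exponential is expanded in powers of \<open>z\<close> and integrated term by term.
  The moment with \<open>k = norm z\<close> dominates the series of norms, so the transform is an
  everywhere convergent power series.\<close>

lemma holomorphic_fourier_integral:
  fixes g :: "real \<Rightarrow> complex"
  assumes [measurable]: "g \<in> borel_measurable borel"
    and int: "\<And>k. integrable lborel (\<lambda>t. norm (g t) * exp (k * \<bar>t\<bar>))"
  shows "fourier_integral g holomorphic_on UNIV"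
proof -
  define a where "a n = (LINT t|lborel. g t * ((- (\<i> * of_real t)) ^ n / fact n))" for n
  have sums: "(\<lambda>n. a n * (z - 0) ^ n) sums fourier_integral g z" for z
  proof -
    define f where "f n t = g t * ((- (\<i> * z * of_real t)) ^ n / fact n)" for n t
    have norm_f: "norm (f n t) = norm (g t) * ((norm z * \<bar>t\<bar>) ^ n / fact n)" for n t
      by (simp add: f_def norm_mult norm_divide norm_power)
    have sums_norm: "(\<lambda>n. norm (f n t)) sums (norm (g t) * exp (norm z * \<bar>t\<bar>))" for t
      unfolding norm_f using exp_converges[of "norm z * \<bar>t\<bar>"]
      by (intro sums_mult) (simp add: scaleR_conv_of_real divide_inverse mult.commute)
    have sums_f: "(\<lambda>n. f n t) sums (g t * exp (- (\<i> * z * of_real t)))" for t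
      unfolding f_def using exp_converges[of "- (\<i> * z * of_real t)"]
      by (intro sums_mult) (simp add: scaleR_conv_of_real divide_inverse mult.commute)
    \<comment> \<open>This majorant gives both the integrability of each term and the summability of
      the integrals of the norms.\<close>
    have part: "(\<Sum>n<N. norm (f n t)) \<le> norm (g t) * exp (norm z * \<bar>t\<bar>)" for N t
      using sums_norm[of t] by (auto simp: sums_iff intro!: sum_le_suminf[of _ "{..<N}", THEN order_trans])
    have [measurable]: "f n \<in> borel_measurable borel" for n
      unfolding f_def by measurable
    have int_f: "integrable lborel (f n)" for n
    proof (rule Bochner_Integration.integrable_bound[OF int[of "norm z"]])
      have "norm (f n t) \<le> norm (g t) * exp (norm z * \<bar>t\<bar>)" for t
        using part[of t "Suc n"] sum_nonneg[of "{..<n}" "\<lambda>i. norm (f i t)"] by simp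
      then show "AE t in lborel. norm (f n t) \<le> norm (norm (g t) * exp (norm z * \<bar>t\<bar>))"
        by auto
    qed auto
    have "(\<lambda>n. integral\<^sup>L lborel (f n)) sums (LINT t|lborel. (\<Sum>n. f n t))"
    proof (rule sums_integral[OF int_f])
      show "AE t in lborel. summable (\<lambda>n. norm (f n t))"
        using sums_norm by (auto simp: sums_iff)
      show "summable (\<lambda>n. (LINT t|lborel. norm (f n t)))"
      proof (rule summableI_nonneg_bounded)
        show "(\<Sum>n<N. (LINT t|lborel. norm (f n t))) \<le> (LINT t|lborel. norm (g t) * exp (norm z * \<bar>t\<bar>))" for N
        proof -
          have "(\<Sum>n<N. (LINT t|lborel. norm (f n t))) = (LINT t|lborel. (\<Sum>n<N. norm (f n t)))"
            using int_f by (intro Bochner_Integration.integral_sum[symmetric]) auto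
          also have "\<dots> \<le> (LINT t|lborel. norm (g t) * exp (norm z * \<bar>t\<bar>))"
            using int_f part by (intro integral_mono int Bochner_Integration.integrable_sum) auto
          finally show ?thesis .
        qed
      qed auto
    qed
    moreover have "integral\<^sup>L lborel (f n) = a n * z ^ n" for n
    proof -
      have "integral\<^sup>L lborel (f n) = (LINT t|lborel. g t * ((- (\<i> * of_real t)) ^ n / fact n) * z ^ n)"
      proof (intro Bochner_Integration.integral_cong refl)
        fix t
        have "- (\<i> * z * of_real t) = - (\<i> * of_real t) * z"
          by simp
        then have "(- (\<i> * z * of_real t)) ^ n = (- (\<i> * of_real t)) ^ n * z ^ n"
          by (simp only: power_mult_distrib)
        then show "f n t = g t * ((- (\<i> * of_real t)) ^ n / fact n) * z ^ n"
          by (simp add: f_def)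
      qed
      then show ?thesis by (simp add: a_def)
    qed
    moreover have "(\<Sum>n. f n t) = g t * exp (- (\<i> * z * of_real t))" for t
      using sums_f by (rule sums_unique[symmetric])
    ultimately show ?thesis by (simp add: fourier_integral_def)
  qed
  have "fourier_integral g holomorphic_on ball 0 r" for r
    using power_series_holomorphic[of 0 r a "fourier_integral g"] sums by blast
  then have "fourier_integral g field_differentiable (at z)" for z
    using holomorphic_onD[of "fourier_integral g" "ball 0 (norm z + 1)" z] at_within_open[of z "ball 0 (norm z + 1)"]
    by auto
  then show ?thesis
    by (auto simp: holomorphic_on_def)
qed

section \<open>Gaussian integrals\<close>

lemma has_bochner_integral_gauss_linear:
  fixes s k :: real
  assumes "s > 0"
  shows "has_bochner_integral lborel (\<lambda>t. exp (- s * t\<^sup>2 + k * t)) (sqrt (pi / s) * exp (k\<^sup>2 / (4 * s)))"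
proof -
  \<comment> \<open>Completing the square shows that the integrand is a multiple of the normal
    density with this standard deviation and mean.\<close>
  define \<sigma> \<mu> where "\<sigma> = 1 / sqrt (2 * s)" and "\<mu> = k / (2 * s)"
  have \<sigma>: "\<sigma> > 0" "\<sigma>\<^sup>2 = 1 / (2 * s)"
    using assms by (auto simp: \<sigma>_def power_divide)
  have eq: "exp (- s * t\<^sup>2 + k * t) = (sqrt (pi / s) * exp (k\<^sup>2 / (4 * s))) * normal_density \<mu> \<sigma> t" for t
  proof -
    have "- (t - \<mu>)\<^sup>2 / (2 * \<sigma>\<^sup>2) = - s * (t - \<mu>)\<^sup>2"
      by (simp add: \<sigma>(2))
    moreover have "- s * t\<^sup>2 + k * t = k\<^sup>2 / (4 * s) + - s * (t - \<mu>)\<^sup>2"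
      using assms by (simp add: \<mu>_def power2_eq_square field_simps)
    ultimately have "- s * t\<^sup>2 + k * t = k\<^sup>2 / (4 * s) + - (t - \<mu>)\<^sup>2 / (2 * \<sigma>\<^sup>2)"
      by simp
    moreover have "sqrt (pi / s) * (1 / sqrt (2 * pi * \<sigma>\<^sup>2)) = 1"
      using assms by (simp add: \<sigma>(2))
    ultimately have "exp (- s * t\<^sup>2 + k * t) = (sqrt (pi / s) * (1 / sqrt (2 * pi * \<sigma>\<^sup>2))) *
        (exp (k\<^sup>2 / (4 * s)) * exp (- (t - \<mu>)\<^sup>2 / (2 * \<sigma>\<^sup>2)))"
      by (simp only: exp_add mult_1_left)
    then show ?thesis
      by (simp only: normal_density_def mult_ac)
  qed
  have "has_bochner_integral lborel (normal_density \<mu> \<sigma>) 1"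
    using \<sigma> by (simp add: has_bochner_integral_iff)
  then show ?thesis
    unfolding eq
    using has_bochner_integral_mult_right[of "sqrt (pi / s) * exp (k\<^sup>2 / (4 * s))" lborel "normal_density \<mu> \<sigma>" 1]
    by simp
qed

text \<open>The characteristic function of the standard normal distribution is taken at
  \<open>- \<omega> / r\<close>. Rescaling the variable by \<open>r = sqrt (2 * s)\<close> turns the
  exponent \<open>- x\<^sup>2 / 2\<close> of the density into
  \<open>- s * x\<^sup>2\<close>.\<close>

lemma fourier_integral_gauss:
  fixes s \<omega> :: real
  assumes "s > 0"
  shows "fourier_integral (\<lambda>t. of_real (exp (- s * t\<^sup>2))) (of_real \<omega>) = of_real (sqrt (pi / s) * exp (- \<omega>\<^sup>2 / (4 * s)))"
proof -
  define r where "r = sqrt (2 * s)"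
  have r: "r > 0" "r\<^sup>2 = 2 * s" using assms by (auto simp: r_def)
  have "complex_of_real (exp (- ((- \<omega> / r)\<^sup>2) / 2)) = (CLINT x|density lborel std_normal_density. iexp ((- \<omega> / r) * x))"
    using fun_cong[OF char_std_normal_distribution, of "- \<omega> / r"] by (simp add: char_def)
  also have "\<dots> = (CLINT x|lborel. std_normal_density x *\<^sub>R iexp ((- \<omega> / r) * x))"
    by (subst integral_density) auto
  also have "\<dots> = r *\<^sub>R (CLINT x|lborel. std_normal_density (r * x) *\<^sub>R iexp ((- \<omega> / r) * (r * x)))"
    using lborel_integral_real_affine[of r "\<lambda>x. std_normal_density x *\<^sub>R iexp ((- \<omega> / r) * x)" 0] r by simp
  also have "\<dots> = r *\<^sub>R (CLINT x|lborel. of_real (1 / sqrt (2 * pi)) * (of_real (exp (- s * x\<^sup>2)) * exp (- (\<i> * of_real \<omega> * of_real x))))"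
    using r by (intro arg_cong2[where f=scaleR] Bochner_Integration.integral_cong refl)
      (simp add: std_normal_density_def power_mult_distrib scaleR_conv_of_real algebra_simps)
  also have "\<dots> = of_real (r / sqrt (2 * pi)) * fourier_integral (\<lambda>t. of_real (exp (- s * t\<^sup>2))) (of_real \<omega>)"
    unfolding fourier_integral_def
    by (subst integral_mult_right_zero) (simp add: scaleR_conv_of_real)
  finally have *: "of_real (r / sqrt (2 * pi)) * fourier_integral (\<lambda>t. of_real (exp (- s * t\<^sup>2))) (of_real \<omega>) = 
      complex_of_real (exp (- \<omega>\<^sup>2 / (4 * s)))"
    using r by (simp add: power_divide)
  have "sqrt (pi / s) * (r / sqrt (2 * pi)) = 1"
    using assms by (simp add: r_def real_sqrt_divide real_sqrt_mult)
  then have "complex_of_real (sqrt (pi / s)) * of_real (r / sqrt (2 * pi)) = 1"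
    by (metis of_real_1 of_real_mult)
  then have "fourier_integral (\<lambda>t. of_real (exp (- s * t\<^sup>2))) (of_real \<omega>) =
     of_real (sqrt (pi / s)) * (of_real (r / sqrt (2 * pi)) * fourier_integral (\<lambda>t. of_real (exp (- s * t\<^sup>2))) (of_real \<omega>))"
    by (simp only: mult.assoc[symmetric] mult_1_left)
  then show ?thesis
    unfolding * by simp
qed

section \<open>Uniqueness of Fourier integrals\<close>

lemma real_distribution_density:
  fixes p :: "real \<Rightarrow> real"
  assumes "integrable lborel p" "\<And>x. 0 \<le> p x" "(LINT x|lborel. p x) = 1"
  shows "real_distribution (density lborel p)"
proof -
  have "emeasure (density lborel p) UNIV = 1"
    using assms by (subst emeasure_density) (auto simp: nn_integral_eq_integral)
  then interpret prob_space "density lborel p"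
    by (intro prob_spaceI) simp
  show ?thesis by unfold_locales auto
qed

text \<open>The positive and negative parts of \<open>h\<close> have equal transforms, hence, at
  frequency 0, equal masses \<open>m\<close>. If \<open>m\<close> is positive, dividing by it gives
  two probability densities with the same characteristic function, and Levy's theorem identifies
  them; if \<open>m\<close> is 0, both parts vanish almost everywhere.\<close>

lemma iexp_integral_zero_imp_AE_zero:
  fixes h :: "real \<Rightarrow> real"
  assumes int: "integrable lborel h"
    and zero: "\<And>u. (CLINT x|lborel. h x *\<^sub>R iexp (u * x)) = 0"
  shows "AE x in lborel. h x = 0"
proof -
  define p n where "p x = max 0 (h x)" and "n x = max 0 (- h x)" for x
  have [measurable]: "h \<in> borel_measurable borel"
    using int by auto
  have h: "h x = p x - n x" for x by (auto simp: p_def n_def)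
  have pn0: "0 \<le> p x" "0 \<le> n x" for x by (auto simp: p_def n_def)
  have int_pn: "integrable lborel p" "integrable lborel n"
    using int unfolding p_def n_def by auto
  have [measurable]: "p \<in> borel_measurable borel" "n \<in> borel_measurable borel"
    using int_pn by auto
  have eq: "(CLINT x|lborel. p x *\<^sub>R iexp (u * x)) = (CLINT x|lborel. n x *\<^sub>R iexp (u * x))" for u
  proof -
    have "integrable lborel (\<lambda>x. p x *\<^sub>R iexp (u * x))" "integrable lborel (\<lambda>x. n x *\<^sub>R iexp (u * x))"
      using pn0 by (auto intro: Bochner_Integration.integrable_bound[OF int_pn(1)] Bochner_Integration.integrable_bound[OF int_pn(2)])
    then show ?thesis
      using zero[of u] by (simp add: h scaleR_diff_left)
  qed
  define m where "m = (LINT x|lborel. p x)"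
  have "complex_of_real (LINT x|lborel. p x) = of_real (LINT x|lborel. n x)"
    using eq[of 0] by (simp add: scaleR_conv_of_real)
  then have m': "m = (LINT x|lborel. n x)"
    unfolding m_def using of_real_eq_iff by blast
  show ?thesis
  proof (cases "m = 0")
    case True
    have "AE x in lborel. p x = 0" "AE x in lborel. n x = 0"
      using integral_nonneg_eq_0_iff_AE[OF int_pn(1)] integral_nonneg_eq_0_iff_AE[OF int_pn(2)] True m' m_def pn0 by auto
    then show ?thesis
      by eventually_elim (simp add: h)
  next
    case False
    then have m: "m > 0"
      using pn0 Bochner_Integration.integral_nonneg[of lborel p] by (simp add: m_def order_less_le)
    have "density lborel (\<lambda>x. ennreal (p x / m)) = density lborel (\<lambda>x. ennreal (n x / m))"
    proof (rule Levy_uniqueness)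
      show "real_distribution (density lborel (\<lambda>x. p x / m))" "real_distribution (density lborel (\<lambda>x. n x / m))"
        using m int_pn pn0 m' m_def by (auto intro!: real_distribution_density)
      show "char (density lborel (\<lambda>x. p x / m)) = char (density lborel (\<lambda>x. n x / m))"
      proof
        fix u
        have *: "char (density lborel (\<lambda>x. q x / m)) u = (CLINT x|lborel. q x *\<^sub>R iexp (u * x)) / of_real m"
          if [measurable]: "q \<in> borel_measurable borel" and "\<And>x. 0 \<le> q x" for q
        proof -
          have "char (density lborel (\<lambda>x. q x / m)) u = (CLINT x|lborel. (q x / m) *\<^sub>R iexp (u * x))"
            unfolding char_def using m that by (subst integral_density) auto
          also have "\<dots> = (CLINT x|lborel. (q x *\<^sub>R iexp (u * x)) / of_real m)"
            by (simp add: scaleR_conv_of_real)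
          finally show ?thesis by simp
        qed
        show "char (density lborel (\<lambda>x. p x / m)) u = char (density lborel (\<lambda>x. n x / m)) u"
          using *[of p] *[of n] eq[of u] pn0 by simp
      qed
    qed
    then have "AE x in lborel. ennreal (p x / m) = ennreal (n x / m)"
      by (intro sigma_finite_measure.density_unique[OF lborel.sigma_finite_measure_axioms]) auto
    then show ?thesis
      by eventually_elim (use m pn0 h in \<open>auto simp: divide_nonneg_nonneg\<close>)
  qed
qed

text \<open>Conjugating the vanishing integrals of \<open>g\<close> shows that those of its
  conjugate vanish too. The real and imaginary parts are linear combinations of the two, so the real
  case applies to each.\<close>

lemma fourier_integral_zero_imp_AE_zero:
  assumes int: "integrable lborel g"
    and zero: "\<And>\<omega>. fourier_integral g (of_real \<omega>) = 0"
  shows "AE t in lborel. g t = 0"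
proof -
  have [measurable]: "g \<in> borel_measurable borel" using int by auto
  have int1: "integrable lborel (\<lambda>t. g t * iexp (u * t))" for u
    by (rule Bochner_Integration.integrable_bound[OF int]) (auto simp: norm_mult)
  have int2: "integrable lborel (\<lambda>t. cnj (g t) * iexp (u * t))" for u
    using integrable_cnj[OF int1[of "- u"]] by (simp add: exp_cnj)
  have g: "(CLINT t|lborel. g t * iexp (u * t)) = 0" for u
    using zero[of "-u"] by (simp add: fourier_integral_def mult.assoc)
  have cnj_g: "(CLINT t|lborel. cnj (g t) * iexp (u * t)) = 0" for u
  proof -
    have "(CLINT t|lborel. cnj (g t) * iexp (u * t)) = (CLINT t|lborel. cnj (g t * iexp (- u * t)))"
      by (simp add: exp_cnj)
    also have "\<dots> = cnj (CLINT t|lborel. g t * iexp (- u * t))"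
      by (rule Bochner_Integration.integral_cnj)
    finally show ?thesis by (simp only: g complex_cnj_zero)
  qed
  have "AE t in lborel. Re (g t) = 0"
  proof (rule iexp_integral_zero_imp_AE_zero)
    fix u
    have "(CLINT t|lborel. Re (g t) *\<^sub>R iexp (u * t)) = (CLINT t|lborel. (g t * iexp (u * t) + cnj (g t) * iexp (u * t)) / 2)"
      by (intro Bochner_Integration.integral_cong refl) (simp add: scaleR_conv_of_real complex_add_cnj flip: distrib_right)
    also have "\<dots> = 0"
      using int1 int2 g cnj_g by simp
    finally show "(CLINT t|lborel. Re (g t) *\<^sub>R iexp (u * t)) = 0" .
  qed (use int in auto)
  moreover have "AE t in lborel. Im (g t) = 0"
  proof (rule iexp_integral_zero_imp_AE_zero)
    fix u
    have "(CLINT t|lborel. Im (g t) *\<^sub>R iexp (u * t)) = (CLINT t|lborel. (g t * iexp (u * t) - cnj (g t) * iexp (u * t)) / (2 * \<i>))"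
    proof (intro Bochner_Integration.integral_cong refl)
      fix t
      have "complex_of_real (Im (g t)) = (g t - cnj (g t)) / (2 * \<i>)"
        by (simp add: complex_diff_cnj nonzero_divide_eq_eq mult_ac)
      then show "Im (g t) *\<^sub>R iexp (u * t) = (g t * iexp (u * t) - cnj (g t) * iexp (u * t)) / (2 * \<i>)"
        by (simp only: scaleR_conv_of_real left_diff_distrib times_divide_eq_left)
    qed
    also have "\<dots> = ((CLINT t|lborel. g t * iexp (u * t)) - (CLINT t|lborel. cnj (g t) * iexp (u * t))) / (2 * \<i>)"
      by (simp only: integral_divide_zero Bochner_Integration.integral_diff[OF int1 int2])
    also have "\<dots> = 0"
      by (simp only: g cnj_g) simp
    finally show "(CLINT t|lborel. Im (g t) *\<^sub>R iexp (u * t)) = 0" .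
  qed (use int in auto)
  ultimately show ?thesis
    by eventually_elim (simp add: complex_eq_iff)
qed

section \<open>Hardy's uncertainty principle\<close>

text \<open>Beyond \<open>T\<close> the Gaussian decay is used; up to \<open>T\<close>, the product
  \<open>k * T\<close> is estimated by completing a square. In this way \<open>k\<close> enters the
  first term only through \<open>exp (k\<^sup>2 / (4 * s))\<close>, the very factor that the
  Gaussian integrals of the second term produce.\<close>

lemma gauss_decay_bound:
  fixes s k t T M m :: real
  assumes "s > 0" "0 \<le> k" "0 \<le> M" "0 \<le> m"
    and decay: "\<bar>t\<bar> > T \<Longrightarrow> m \<le> M * exp (- s * t\<^sup>2)"
  shows "m * exp (k * \<bar>t\<bar>) \<le> exp (s * T\<^sup>2 + k\<^sup>2 / (4 * s)) * m + M * (exp (- s * t\<^sup>2 + k * t) + exp (- s * t\<^sup>2 + (- k) * t))"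
proof (cases "\<bar>t\<bar> > T")
  case True
  have "m * exp (k * \<bar>t\<bar>) \<le> M * exp (- s * t\<^sup>2) * exp (k * \<bar>t\<bar>)"
    using decay[OF True] by (intro mult_right_mono) auto
  also have "\<dots> = M * exp (- s * t\<^sup>2 + k * \<bar>t\<bar>)"
    by (simp only: exp_add mult.assoc)
  also have "\<dots> \<le> M * (exp (- s * t\<^sup>2 + k * t) + exp (- s * t\<^sup>2 + (- k) * t))"
  proof (intro mult_left_mono \<open>0 \<le> M\<close>)
    have "k * \<bar>t\<bar> = k * t \<or> k * \<bar>t\<bar> = (- k) * t"
      by (cases "t \<ge> 0") auto
    then show "exp (- s * t\<^sup>2 + k * \<bar>t\<bar>) \<le> exp (- s * t\<^sup>2 + k * t) + exp (- s * t\<^sup>2 + (- k) * t)"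
      by (metis add_increasing add_increasing2 exp_ge_zero order_refl)
  qed
  finally show ?thesis
    using \<open>0 \<le> m\<close> by (smt (verit) exp_ge_zero mult_nonneg_nonneg)
next
  case False
  have "0 \<le> (k - 2 * s * T)\<^sup>2 / (4 * s)"
    using assms by simp
  also have "\<dots> = s * T\<^sup>2 + k\<^sup>2 / (4 * s) - k * T"
    using assms by (simp add: power2_eq_square field_simps)
  finally have "k * T \<le> s * T\<^sup>2 + k\<^sup>2 / (4 * s)" by simp
  moreover have "k * \<bar>t\<bar> \<le> k * T"
    using False assms by (intro mult_left_mono) auto
  ultimately have "m * exp (k * \<bar>t\<bar>) \<le> exp (s * T\<^sup>2 + k\<^sup>2 / (4 * s)) * m"
    using \<open>0 \<le> m\<close> by (auto simp: mult.commute intro!: mult_left_mono)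
  moreover have "0 \<le> M * (exp (- s * t\<^sup>2 + k * t) + exp (- s * t\<^sup>2 + (- k) * t))"
    using assms by (intro mult_nonneg_nonneg add_nonneg_nonneg) auto
  ultimately show ?thesis by linarith
qed

text \<open>The pointwise majorant is integrated. What matters is the sharp exponent
  \<open>k\<^sup>2 / (4 * s)\<close> with a prefactor independent of \<open>k\<close>: with
  \<open>k = \<bar>Im z\<bar>\<close> it is cancelled exactly by the modulus of
  \<open>exp (z\<^sup>2 / (4 * s))\<close>.\<close>

lemma gauss_decay_exp_moment:
  fixes g :: "real \<Rightarrow> complex" and s k T M :: real
  assumes "s > 0" "0 \<le> M" "0 \<le> k" and int: "integrable lborel g"
    and decay: "AE t in lborel. \<bar>t\<bar> > T \<longrightarrow> norm (g t) \<le> M * exp (- s * t\<^sup>2)"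
  shows "integrable lborel (\<lambda>t. norm (g t) * exp (k * \<bar>t\<bar>))"
    and "(LINT t|lborel. norm (g t) * exp (k * \<bar>t\<bar>)) \<le>
      (exp (s * T\<^sup>2) * (LINT t|lborel. norm (g t)) + 2 * M * sqrt (pi / s)) * exp (k\<^sup>2 / (4 * s))"
proof -
  have [measurable]: "g \<in> borel_measurable borel" using int by auto
  let ?B = "\<lambda>t. exp (s * T\<^sup>2 + k\<^sup>2 / (4 * s)) * norm (g t) + M * (exp (- s * t\<^sup>2 + k * t) + exp (- s * t\<^sup>2 + (- k) * t))"
  let ?G = "sqrt (pi / s) * exp (k\<^sup>2 / (4 * s))"
  have B: "has_bochner_integral lborel ?B
     (exp (s * T\<^sup>2 + k\<^sup>2 / (4 * s)) * (LINT t|lborel. norm (g t)) + M * (?G + ?G))"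
    using has_bochner_integral_gauss_linear[OF \<open>s > 0\<close>, of k] has_bochner_integral_gauss_linear[OF \<open>s > 0\<close>, of "-k"]
    by (intro has_bochner_integral_add has_bochner_integral_mult_right has_bochner_integral_integrable integrable_norm int) auto
  have le: "AE t in lborel. norm (g t) * exp (k * \<bar>t\<bar>) \<le> ?B t"
    using decay
  proof eventually_elim
    case (elim t)
    then show ?case
      using assms by (intro gauss_decay_bound) auto
  qed
  have int_B: "integrable lborel ?B"
    using B by (rule integrable.intros)
  show I: "integrable lborel (\<lambda>t. norm (g t) * exp (k * \<bar>t\<bar>))"
    by (rule Bochner_Integration.integrable_bound[OF int_B]) (use le in auto)
  have "(LINT t|lborel. norm (g t) * exp (k * \<bar>t\<bar>)) \<le> integral\<^sup>L lborel ?B"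
    by (intro integral_mono_AE I int_B le)
  also have "\<dots> = exp (s * T\<^sup>2 + k\<^sup>2 / (4 * s)) * (LINT t|lborel. norm (g t)) + M * (?G + ?G)"
    using B by (rule has_bochner_integral_integral_eq)
  also have "\<dots> = (exp (s * T\<^sup>2) * (LINT t|lborel. norm (g t)) + 2 * M * sqrt (pi / s)) * exp (k\<^sup>2 / (4 * s))"
    by (simp add: exp_add algebra_simps)
  finally show "(LINT t|lborel. norm (g t) * exp (k * \<bar>t\<bar>)) \<le> \<dots>" .
qed

text \<open>The exponents \<open>s\<close> and \<open>1 / (4 * s)\<close> are the critical pair,
  since the Gaussian itself attains both up to constants. The bound on \<open>g\<close> concerns a
  class modulo null sets, whereas the transform is a continuous function and is bounded
  pointwise.\<close>

theorem hardy_uncertainty: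
  fixes g :: "real \<Rightarrow> complex" and s T M W K :: real
  assumes "s > 0" "0 \<le> M" and int: "integrable lborel g"
    and decay: "AE t in lborel. \<bar>t\<bar> > T \<longrightarrow> norm (g t) \<le> M * exp (- s * t\<^sup>2)"
    and decay': "\<And>\<omega>. \<bar>\<omega>\<bar> > W \<Longrightarrow> norm (fourier_integral g (of_real \<omega>)) \<le> K * exp (- \<omega>\<^sup>2 / (4 * s))"
  obtains C where "AE t in lborel. g t = C * of_real (exp (- s * t\<^sup>2))"
proof -
  have [measurable]: "g \<in> borel_measurable borel" using int by auto
  define A where "A = exp (s * T\<^sup>2) * (LINT t|lborel. norm (g t)) + 2 * M * sqrt (pi / s)"
  have A0: "0 \<le> A" using assms by (simp add: A_def)
  have moment: "integrable lborel (\<lambda>t. norm (g t) * exp (k * \<bar>t\<bar>))" if "0 \<le> k" for k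
    using gauss_decay_exp_moment(1)[OF assms(1,2) that int decay] .
  have moment': "integrable lborel (\<lambda>t. norm (g t) * exp (k * \<bar>t\<bar>))" for k
    by (rule Bochner_Integration.integrable_bound[OF moment[of "\<bar>k\<bar>"]])
      (auto intro!: AE_I2 mult_left_mono mult_right_mono)
  define H where "H z = fourier_integral g z * exp (z\<^sup>2 / of_real (4 * s))" for z
  have "H holomorphic_on UNIV"
    unfolding H_def using \<open>s > 0\<close> by (intro holomorphic_intros holomorphic_fourier_integral moment') auto
  moreover have growth: "norm (H z) \<le> A * exp ((1 / (4 * s)) * (Re z)\<^sup>2)" for z
  proof -
    have 1: "norm (fourier_integral g z) \<le> A * exp (\<bar>Im z\<bar>\<^sup>2 / (4 * s))"
      unfolding A_def
      by (rule order_trans[OF norm_fourier_integral_le[OF _ moment] gauss_decay_exp_moment(2)[OF assms(1,2) _ int decay]]) auto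
    \<comment> \<open>This modulus decreases in \<open>\<bar>Im z\<bar>\<close> at exactly the rate
      at which the transform may grow, so that only \<open>Re z\<close> remains in the
      bound.\<close>
    have 2: "norm (exp (z\<^sup>2 / of_real (4 * s))) = exp (((Re z)\<^sup>2 - (Im z)\<^sup>2) / (4 * s))"
      by (simp only: norm_exp_eq_Re Re_divide_of_real) (simp add: power2_eq_square)
    have "norm (H z) \<le> A * exp (\<bar>Im z\<bar>\<^sup>2 / (4 * s)) * exp (((Re z)\<^sup>2 - (Im z)\<^sup>2) / (4 * s))"
      unfolding H_def norm_mult 2 by (rule mult_right_mono[OF 1 exp_ge_zero])
    also have "\<dots> = A * exp ((1 / (4 * s)) * (Re z)\<^sup>2)"
      by (simp add: exp_add[symmetric] diff_divide_distrib mult.assoc)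
    finally show ?thesis .
  qed
  \<comment> \<open>Beyond \<open>W\<close> the assumed decay cancels the exponential factor and
    leaves \<open>K\<close>; up to \<open>W\<close> the growth bound is itself bounded.\<close>
  moreover have "norm (H (of_real x)) \<le> max (A * exp ((1 / (4 * s)) * W\<^sup>2)) K" for x
  proof (cases "\<bar>x\<bar> > W")
    case True
    have 1: "norm (exp ((complex_of_real x)\<^sup>2 / of_real (4 * s))) = exp (x\<^sup>2 / (4 * s))"
      by (simp only: norm_exp_eq_Re Re_divide_of_real) (simp add: power2_eq_square)
    have "norm (H (of_real x)) \<le> K * exp (- x\<^sup>2 / (4 * s)) * exp (x\<^sup>2 / (4 * s))"
      unfolding H_def norm_mult 1 by (rule mult_right_mono[OF decay'[OF True] exp_ge_zero])
    also have "\<dots> = K" by (simp add: exp_minus)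
    finally show ?thesis by simp
  next
    case False
    then have "x\<^sup>2 \<le> W\<^sup>2" by (intro abs_le_square_iff[THEN iffD1]) auto
    then have "A * exp ((1 / (4 * s)) * x\<^sup>2) \<le> A * exp ((1 / (4 * s)) * W\<^sup>2)"
      using A0 \<open>s > 0\<close> by (intro mult_left_mono) (auto simp: divide_right_mono)
    then show ?thesis using growth[of "of_real x"] by simp
  qed
  ultimately obtain C where C: "H z = C" for z
    using holomorphic_gauss_growth_constant[of H "1 / (4 * s)" A] \<open>s > 0\<close> by (metis divide_nonneg_pos mult_pos_pos zero_le_one zero_less_numeral)
  have ft_g: "fourier_integral g (of_real \<omega>) = C * of_real (exp (- \<omega>\<^sup>2 / (4 * s)))" for \<omega>
  proof -
    let ?G = "complex_of_real (exp (- \<omega>\<^sup>2 / (4 * s)))" and ?E = "exp ((complex_of_real \<omega>)\<^sup>2 / of_real (4 * s))"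
    have "?E * ?G = 1"
      by (simp flip: exp_add exp_of_real)
    then have "fourier_integral g (of_real \<omega>) = (fourier_integral g (of_real \<omega>) * ?E) * ?G"
      by (simp only: mult.assoc mult_1_right)
    also have "fourier_integral g (of_real \<omega>) * ?E = C"
      using C[of "of_real \<omega>"] by (simp only: H_def)
    finally show ?thesis .
  qed
  \<comment> \<open>The transform of the Gaussian carries the constant \<open>sqrt (pi / s)\<close>;
    with this normalisation \<open>C'\<close> times the Gaussian has the same transform as
    \<open>g\<close>.\<close>
  define C' where "C' = C / of_real (sqrt (pi / s))"
  have int_gauss: "integrable lborel (\<lambda>t. C' * complex_of_real (exp (- s * t\<^sup>2)))"
    using has_bochner_integral_gauss_linear[OF \<open>s > 0\<close>, of 0] by (auto simp: has_bochner_integral_iff)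
  have ft_int: "integrable lborel (\<lambda>t. h t * exp (- (\<i> * of_real \<omega> * of_real t)))" if "integrable lborel h" for h :: "real \<Rightarrow> complex" and \<omega>
    by (rule Bochner_Integration.integrable_bound[OF that]) (use that in \<open>auto simp: norm_mult\<close>)
  have "AE t in lborel. g t - C' * complex_of_real (exp (- s * t\<^sup>2)) = 0"
  proof (rule fourier_integral_zero_imp_AE_zero)
    show "fourier_integral (\<lambda>t. g t - C' * complex_of_real (exp (- s * t\<^sup>2))) (of_real \<omega>) = 0" for \<omega>
    proof -
      have "fourier_integral (\<lambda>t. g t - C' * complex_of_real (exp (- s * t\<^sup>2))) (of_real \<omega>) =
        fourier_integral g (of_real \<omega>) - fourier_integral (\<lambda>t. C' * complex_of_real (exp (- s * t\<^sup>2))) (of_real \<omega>)"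
        unfolding fourier_integral_def left_diff_distrib
        by (rule Bochner_Integration.integral_diff[OF ft_int[OF int] ft_int[OF int_gauss]])
      also have "fourier_integral (\<lambda>t. C' * complex_of_real (exp (- s * t\<^sup>2))) (of_real \<omega>) =
         C' * fourier_integral (\<lambda>t. complex_of_real (exp (- s * t\<^sup>2))) (of_real \<omega>)"
        unfolding fourier_integral_def mult.assoc by (rule integral_mult_right_zero)
      also have "\<dots> = C * of_real (exp (- \<omega>\<^sup>2 / (4 * s)))"
        unfolding fourier_integral_gauss[OF \<open>s > 0\<close>] using \<open>s > 0\<close> by (simp add: C'_def)
      finally show ?thesis by (simp add: ft_g)
    qed
  qed (intro Bochner_Integration.integrable_diff int int_gauss)
  then show ?thesis
    by (intro that[of C']) (auto elim: eventually_mono)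
qed

section \<open>The offset linear canonical transform\<close>

text \<open>The points of \<open>S\<close> where the inequality fails form an open null set, which
  must be empty. This turns a bound known almost everywhere for a representative of the transform
  into a pointwise bound for the continuous Fourier integral.\<close>

lemma AE_continuous_le_imp_le:
  fixes \<phi> \<psi> :: "real \<Rightarrow> real"
  assumes "open S" "continuous_on S \<phi>" "continuous_on S \<psi>"
    and ae: "AE x in lebesgue. x \<in> S \<longrightarrow> \<phi> x \<le> \<psi> x" and "x \<in> S"
  shows "\<phi> x \<le> \<psi> x"
proof (rule ccontr)
  let ?U = "S \<inter> (\<lambda>x. \<phi> x - \<psi> x) -` {0<..}"
  assume "\<not> \<phi> x \<le> \<psi> x"
  then have "x \<in> ?U" using \<open>x \<in> S\<close> by auto
  moreover have "open ?U"
    using assms by (intro continuous_open_preimage continuous_intros) auto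
  moreover have "AE x in lebesgue. x \<notin> ?U"
    using ae by eventually_elim auto
  then have "?U \<in> null_sets lebesgue"
    using \<open>open ?U\<close> by (subst AE_iff_null_sets) auto
  ultimately show False
    using open_not_negligible negligible_iff_null_sets by blast
qed

text \<open>The factor of the kernel that depends on \<open>t\<close> alone; its linear term comes
  from the offset \<tau>. Being unimodular, it changes neither the decay nor the square
  integrability of \<open>f\<close>.\<close>

definition olct_chirp :: "real \<Rightarrow> real \<Rightarrow> real \<Rightarrow> real \<Rightarrow> complex" where
  "olct_chirp a b \<tau> t = exp (\<i> * of_real (a / (2 * b) * t\<^sup>2 + 1 / b * t * \<tau>))"

definition olct_factor :: "real \<Rightarrow> real \<Rightarrow> real \<Rightarrow> real \<Rightarrow> real \<Rightarrow> complex" where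
  "olct_factor b d \<tau> \<eta> u = 1 / csqrt (\<i> * complex_of_real (2 * pi * b)) *
     exp (\<i> * of_real (d / (2 * b) * (u\<^sup>2 + \<tau>\<^sup>2) - 1 / b * u * (d * \<tau> - b * \<eta>)))"

lemma norm_olct_chirp [simp]: "norm (olct_chirp a b \<tau> t) = 1"
  unfolding olct_chirp_def by (rule norm_exp_i_times)

lemma norm_olct_factor:
  assumes "b > 0"
  shows "norm (olct_factor b d \<tau> \<eta> u) = 1 / sqrt (2 * pi * b)"
  using assms unfolding olct_factor_def norm_mult norm_exp_i_times norm_divide norm_csqrt
  by (simp add: norm_mult)

text \<open>The only mixed term of the exponent is the product of \<open>t\<close> and
  \<open>u / b\<close>, so apart from factors in one variable the kernel is the Fourier kernel at
  frequency \<open>u / b\<close>.\<close>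

lemma olct_kernel_eq:
  "olct_kernel a b c d \<tau> \<eta> t u =
     olct_factor b d \<tau> \<eta> u * (olct_chirp a b \<tau> t * exp (- (\<i> * of_real (u / b) * of_real t)))"
proof -
  have "\<i> * complex_of_real (a / (2 * b) * t\<^sup>2) - \<i> * complex_of_real (1 / b * t * (u - \<tau>))
      - \<i> * complex_of_real (1 / b * u * (d * \<tau> - b * \<eta>)) + \<i> * complex_of_real (d / (2 * b) * (u\<^sup>2 + \<tau>\<^sup>2)) =
     \<i> * of_real (d / (2 * b) * (u\<^sup>2 + \<tau>\<^sup>2) - 1 / b * u * (d * \<tau> - b * \<eta>)) +
     (\<i> * of_real (a / (2 * b) * t\<^sup>2 + 1 / b * t * \<tau>) + - (\<i> * of_real (u / b) * of_real t))"
    by (simp add: algebra_simps add_divide_distrib diff_divide_distrib)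
  then show ?thesis
    unfolding olct_kernel_def olct_chirp_def olct_factor_def by (simp only: exp_add mult.assoc)
qed

lemma continuous_on_olct_factor: "continuous_on UNIV (olct_factor b d \<tau> \<eta>)"
  unfolding olct_factor_def by (intro continuous_intros)

lemma measurable_olct_chirp [measurable]: "olct_chirp a b \<tau> \<in> borel_measurable borel"
  unfolding olct_chirp_def by measurable

text \<open>For integrable \<open>g\<close> the truncated integrals converge pointwise, and by Fatou's lemma the limit
  agrees with the limit in \<open>L\<^sup>2\<close>.\<close>

lemma has_olct_eq_fourier_integral:
  assumes olct: "has_olct a b c d \<tau> \<eta> f F"
    and int: "integrable lborel g"
    and g: "AE t in lborel. f t * olct_chirp a b \<tau> t = g t"
  shows "AE u in lebesgue. F u = olct_factor b d \<tau> \<eta> u * fourier_integral g (of_real (u / b))"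
proof -
  have [measurable]: "g \<in> borel_measurable borel" using int by auto
  have f_meas: "f \<in> borel_measurable lebesgue" and F_meas [measurable]: "F \<in> borel_measurable lebesgue"
    using olct by (auto simp: has_olct_def L2_def)
  define gR where "gR R t = indicator {-R..R} t *\<^sub>R g t" for R t
  have [measurable]: "gR R \<in> borel_measurable borel" for R
    unfolding gR_def by measurable
  have truncated: "(LINT t:{-R..R}|lebesgue. f t * olct_kernel a b c d \<tau> \<eta> t u) =
      olct_factor b d \<tau> \<eta> u * fourier_integral (gR R) (of_real (u / b))" for R u
  proof -
    let ?h = "\<lambda>t. olct_factor b d \<tau> \<eta> u * (gR R t * exp (- (\<i> * of_real (u / b) * of_real t)))"
    have ae: "AE t in lebesgue. indicator {-R..R} t *\<^sub>R (f t * olct_kernel a b c d \<tau> \<eta> t u) = ?h t"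
      using AE_completion[OF g]
    proof eventually_elim
      case (elim t)
      show ?case
        unfolding gR_def elim[symmetric] olct_kernel_eq by (simp add: scaleR_conv_of_real mult_ac)
    qed
    have h [measurable]: "?h \<in> borel_measurable borel" by measurable
    have h': "?h \<in> borel_measurable lebesgue"
      using h by (intro measurable_completion) simp
    have "(LINT t:{-R..R}|lebesgue. f t * olct_kernel a b c d \<tau> \<eta> t u) = (LINT t|lebesgue. ?h t)"
      unfolding set_lebesgue_integral_def
    proof (rule integral_cong_AE[OF _ h' ae])
      have "(\<lambda>t. olct_kernel a b c d \<tau> \<eta> t u) \<in> borel_measurable borel"
        unfolding olct_kernel_eq by measurable
      then have "(\<lambda>t. olct_kernel a b c d \<tau> \<eta> t u) \<in> borel_measurable lebesgue"
        by (intro measurable_completion) simp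
      then show "(\<lambda>t. indicator {-R..R} t *\<^sub>R (f t * olct_kernel a b c d \<tau> \<eta> t u)) \<in> borel_measurable lebesgue"
        by (intro borel_measurable_scaleR borel_measurable_indicator borel_measurable_times f_meas) auto
    qed
    also have "\<dots> = (LINT t|lborel. ?h t)"
      by (rule integral_completion) simp
    also have "\<dots> = olct_factor b d \<tau> \<eta> u * fourier_integral (gR R) (of_real (u / b))"
      unfolding fourier_integral_def by (rule integral_mult_right_zero)
    finally show ?thesis .
  qed
  \<comment> \<open>Bounded support gives all exponential moments, so the truncated transform is
    continuous in \<open>u\<close>; this supplies the measurability for Fatou's lemma.\<close>
  have cont: "continuous_on UNIV (\<lambda>u. olct_factor b d \<tau> \<eta> u * fourier_integral (gR R) (of_real (u / b)))" for R
  proof -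
    have "integrable lborel (\<lambda>t. norm (gR R t) * exp (k * \<bar>t\<bar>))" for k
    proof (rule Bochner_Integration.integrable_bound[of _ "\<lambda>t. norm (g t) * exp (\<bar>k\<bar> * \<bar>R\<bar>)"])
      have "k * \<bar>t\<bar> \<le> \<bar>k\<bar> * \<bar>R\<bar>" if "-R \<le> t" "t \<le> R" for t
        using that by (intro mult_mono) auto
      then show "AE t in lborel. norm (norm (gR R t) * exp (k * \<bar>t\<bar>)) \<le> norm (norm (g t) * exp (\<bar>k\<bar> * \<bar>R\<bar>))"
        by (auto simp: gR_def indicator_def intro!: AE_I2 mult_left_mono)
    qed (use int in auto)
    then have "continuous_on UNIV (fourier_integral (gR R))"
      by (intro holomorphic_on_imp_continuous_on holomorphic_fourier_integral) auto
    moreover have "continuous_on UNIV (\<lambda>u. complex_of_real (u / b))"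
      unfolding divide_inverse by (intro continuous_intros)
    ultimately have "continuous_on UNIV (\<lambda>u. fourier_integral (gR R) (of_real (u / b)))"
      by (rule continuous_on_compose2) auto
    then show ?thesis
      by (intro continuous_on_mult continuous_on_olct_factor)
  qed
  \<comment> \<open>Fatou's lemma concerns sequences, so the truncation radius is restricted to
    natural numbers.\<close>
  define I where "I n u = ennreal ((cmod (F u - olct_factor b d \<tau> \<eta> u * fourier_integral (gR (real n)) (of_real (u / b))))\<^sup>2)" for n u
  have [measurable]: "(\<lambda>u. olct_factor b d \<tau> \<eta> u * fourier_integral (gR (real n)) (of_real (u / b))) \<in> borel_measurable lebesgue" for n
    using borel_measurable_continuous_onI[OF cont] by (intro measurable_completion) simp
  have [measurable]: "I n \<in> borel_measurable lebesgue" for n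
    unfolding I_def by measurable
  have "(\<lambda>n. \<integral>\<^sup>+ u. I n u \<partial>lebesgue) \<longlonglongrightarrow> 0"
    using olct unfolding has_olct_def truncated I_def
    by (auto intro: filterlim_compose[OF _ filterlim_real_sequentially])
  then have "liminf (\<lambda>n. \<integral>\<^sup>+ u. I n u \<partial>lebesgue) = 0"
    by (intro lim_imp_Liminf) auto
  then have "(\<integral>\<^sup>+ u. liminf (\<lambda>n. I n u) \<partial>lebesgue) = 0"
    using nn_integral_liminf[of I lebesgue] by simp
  then have "AE u in lebesgue. liminf (\<lambda>n. I n u) = 0"
    by (subst (asm) nn_integral_0_iff_AE) measurable
  moreover have "liminf (\<lambda>n. I n u) = ennreal ((cmod (F u - olct_factor b d \<tau> \<eta> u * fourier_integral g (of_real (u / b))))\<^sup>2)" for u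
  proof (rule lim_imp_Liminf)
    have "(\<lambda>n. fourier_integral (gR (real n)) (of_real (u / b))) \<longlonglongrightarrow> fourier_integral g (of_real (u / b))"
      unfolding fourier_integral_def
    proof (rule integral_dominated_convergence[where w = "\<lambda>t. norm (g t)"])
      show "AE t in lborel. (\<lambda>n. gR (real n) t * exp (- (\<i> * of_real (u / b) * of_real t))) \<longlonglongrightarrow> g t * exp (- (\<i> * of_real (u / b) * of_real t))"
      proof (intro AE_I2 tendsto_intros)
        fix t
        have "eventually (\<lambda>n. gR (real n) t = g t) sequentially"
          using eventually_ge_at_top[of "nat \<lceil>\<bar>t\<bar>\<rceil>"]
          by eventually_elim (auto simp: gR_def indicator_def nat_le_iff ceiling_le_iff abs_le_iff)
        then show "(\<lambda>n. gR (real n) t) \<longlonglongrightarrow> g t"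
          by (rule tendsto_eventually)
      qed
      show "AE t in lborel. norm (gR (real n) t * exp (- (\<i> * of_real (u / b) * of_real t))) \<le> norm (g t)" for n
        by (auto simp: gR_def norm_mult indicator_def)
    qed (use int in auto)
    then show "(\<lambda>n. I n u) \<longlonglongrightarrow> ennreal ((cmod (F u - olct_factor b d \<tau> \<eta> u * fourier_integral g (of_real (u / b))))\<^sup>2)"
      unfolding I_def by (intro tendsto_intros)
  qed simp
  ultimately show ?thesis
    by (auto elim!: eventually_mono)
qed

text \<open>Members of \<open>L2\<close> are only Lebesgue measurable, while Fourier integrals are
  taken over \<open>lborel\<close>. A Borel representative is assembled from those of the real and
  imaginary parts.\<close>

lemma borel_measurable_lebesgue_AE_eq_borel:
  fixes f :: "real \<Rightarrow> complex"
  assumes [measurable]: "f \<in> borel_measurable lebesgue"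
  obtains f' where "f' \<in> borel_measurable borel" "AE t in lborel. f t = f' t"
proof -
  have "(\<lambda>t. Re (f t)) \<in> borel_measurable lebesgue" "(\<lambda>t. Im (f t)) \<in> borel_measurable lebesgue"
    by measurable
  then obtain p q where [measurable]: "p \<in> borel_measurable lborel" "q \<in> borel_measurable lborel"
    and pq: "AE t in lborel. Re (f t) = p t" "AE t in lborel. Im (f t) = q t"
    by (metis completion_ex_borel_measurable_real)
  have "AE t in lborel. f t = Complex (p t) (q t)"
    using pq by eventually_elim (simp add: complex_eq_iff)
  moreover have "(\<lambda>t. Complex (p t) (q t)) \<in> borel_measurable borel"
    unfolding Complex_eq by measurable
  ultimately show ?thesis using that by blast
qed

lemma ae_bigoE:
  assumes "ae_bigo f h" "\<And>t. h t > 0"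
  obtains c T where "c > 0" "AE t in lebesgue. \<bar>t\<bar> > T \<longrightarrow> norm (f t) \<le> c * h t"
proof -
  obtain k where k: "AE t in lebesgue. k t = f t" "(\<lambda>t. cmod (k t)) \<in> O[at_infinity](h)"
    using assms(1) by (auto simp: ae_bigo_def)
  from k(2) obtain c where c: "c > 0" "eventually (\<lambda>t. norm (cmod (k t)) \<le> c * norm (h t)) at_infinity"
    by (rule landau_o.bigE)
  then obtain T where T: "\<And>t. T \<le> norm t \<Longrightarrow> norm (cmod (k t)) \<le> c * norm (h t)"
    by (auto simp: eventually_at_infinity)
  have "AE t in lebesgue. \<bar>t\<bar> > T \<longrightarrow> norm (f t) \<le> c * h t"
    using k(1)
  proof eventually_elim
    case (elim t)
    then show ?case
      using T[of t] assms(2)[of t] by auto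
  qed
  then show ?thesis using that c by blast
qed

theorem theorem3p4:
  fixes a b c d \<tau> \<eta> \<alpha> :: real and f F :: "real \<Rightarrow> complex"
  assumes "a * d - b * c = 1" and "b > 0"
    and "f \<in> L2"
    and "has_olct a b c d \<tau> \<eta> f F"
    and "\<alpha> > 0"
    and "ae_bigo f (\<lambda>t. exp (- (pi * \<alpha> * t\<^sup>2)))"
    and "ae_bigo F (\<lambda>u. exp (- (u\<^sup>2 / (4 * pi * \<alpha> * b\<^sup>2))))"
  shows "\<exists>C :: complex. AE t in lebesgue.
    f t = C * exp (- (complex_of_real (pi * \<alpha>) + \<i> * complex_of_real (a / (2 * b))) * complex_of_real (t\<^sup>2)
                   - \<i> * complex_of_real (1 / b * t * \<tau>))"
proof -
  define s where "s = pi * \<alpha>"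
  have s: "s > 0" using \<open>\<alpha> > 0\<close> by (simp add: s_def)
  have f_L2: "f \<in> borel_measurable lebesgue" "integrable lebesgue (\<lambda>t. (cmod (f t))\<^sup>2)"
    using \<open>f \<in> L2\<close> by (auto simp: L2_def)
  obtain f' where [measurable]: "f' \<in> borel_measurable borel" and f': "AE t in lborel. f t = f' t"
    using borel_measurable_lebesgue_AE_eq_borel[OF f_L2(1)] .
  define g where "g t = f' t * olct_chirp a b \<tau> t" for t
  have [measurable]: "g \<in> borel_measurable borel" unfolding g_def by measurable
  have f_g: "AE t in lborel. f t * olct_chirp a b \<tau> t = g t"
    using f' by eventually_elim (simp add: g_def)
  have norm_g: "AE t in lborel. norm (f t) = norm (g t)"
    using f' by eventually_elim (simp add: g_def norm_mult)
  obtain M T where M: "M > 0" "AE t in lebesgue. \<bar>t\<bar> > T \<longrightarrow> norm (f t) \<le> M * exp (- (pi * \<alpha> * t\<^sup>2))"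
    using ae_bigoE[OF assms(6)] by auto
  have decay: "AE t in lborel. \<bar>t\<bar> > T \<longrightarrow> norm (g t) \<le> M * exp (- s * t\<^sup>2)"
    using M(2)[unfolded AE_completion_iff] norm_g by eventually_elim (simp add: s_def)
  have sq_g: "integrable lborel (\<lambda>t. (norm (g t))\<^sup>2)"
  proof -
    have "integrable lebesgue (\<lambda>t. (norm (g t))\<^sup>2)"
      using f_L2(2)
    proof (rule integrable_cong_AE_imp)
      show "(\<lambda>t. (norm (g t))\<^sup>2) \<in> borel_measurable lebesgue"
        by (intro measurable_completion) simp
      show "AE t in lebesgue. (norm (f t))\<^sup>2 = (norm (g t))\<^sup>2"
        using AE_completion[OF norm_g] by eventually_elim simp
    qed
    then show ?thesis
      by (subst (asm) integrable_completion) auto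
  qed
  \<comment> \<open>On \<open>{-T..T}\<close> the inequality
    \<open>norm (g t) \<le> 1 + (norm (g t))\<^sup>2\<close> reduces integrability to square
    integrability; outside, the Gaussian bound takes over.\<close>
  have int: "integrable lborel g"
  proof (rule Bochner_Integration.integrable_bound[of _ "\<lambda>t. (indicator {-T..T} t + (norm (g t))\<^sup>2) + M * exp (- s * t\<^sup>2)"])
    have "integrable lborel (\<lambda>t. exp (- s * t\<^sup>2))"
      using has_bochner_integral_gauss_linear[OF s, of 0] by (auto simp: has_bochner_integral_iff)
    then show "integrable lborel (\<lambda>t. (indicator {-T..T} t + (norm (g t))\<^sup>2) + M * exp (- s * t\<^sup>2))"
      using sq_g by (intro Bochner_Integration.integrable_add integrable_mult_right integrable_real_indicator)
         (auto simp: emeasure_lborel_Icc_eq)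
    show "AE t in lborel. norm (g t) \<le> norm ((indicator {-T..T} t + (norm (g t))\<^sup>2) + M * exp (- s * t\<^sup>2))"
      using decay
    proof eventually_elim
      case (elim t)
      have "norm (g t) \<le> (indicator {-T..T} t + (norm (g t))\<^sup>2) + M * exp (- s * t\<^sup>2)"
      proof (cases "\<bar>t\<bar> > T")
        case True
        then show ?thesis using elim by (smt (verit) indicator_pos_le zero_le_power2)
      next
        case False
        have "0 \<le> (norm (g t) - 1)\<^sup>2" by simp
        then have "norm (g t) + norm (g t) \<le> 1 + (norm (g t))\<^sup>2"
          by (simp add: power2_diff)
        then have "norm (g t) \<le> 1 + (norm (g t))\<^sup>2"
          using norm_ge_zero[of "g t"] by linarith
        moreover have "indicator {-T..T} t = (1::real)" using False by (auto simp: indicator_def)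
        moreover have "0 \<le> M * exp (- s * t\<^sup>2)" using M(1) by simp
        ultimately show ?thesis by linarith
      qed
      then show ?case by simp
    qed
  qed simp
  have F_eq: "AE u in lebesgue. F u = olct_factor b d \<tau> \<eta> u * fourier_integral g (of_real (u / b))"
    by (rule has_olct_eq_fourier_integral[OF assms(4) int f_g])
  obtain K W where K: "K > 0" "AE u in lebesgue. \<bar>u\<bar> > W \<longrightarrow> norm (F u) \<le> K * exp (- (u\<^sup>2 / (4 * pi * \<alpha> * b\<^sup>2)))"
    using ae_bigoE[OF assms(7)] by auto
  \<comment> \<open>The modulus of \<open>olct_factor\<close> is
    \<open>1 / sqrt (2 * pi * b)\<close>, so passing from \<open>F\<close> to the Fourier integral
    multiplies the constant by its inverse.\<close>
  let ?P = "K * sqrt (2 * pi * b)"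
  have ae: "AE u in lebesgue. u \<in> {u. \<bar>u\<bar> > W} \<longrightarrow> norm (fourier_integral g (of_real (u / b))) \<le> ?P * exp (- ((u / b)\<^sup>2 / (4 * s)))"
    using K(2) F_eq
  proof eventually_elim
    case (elim u)
    show ?case
    proof
      assume "u \<in> {u. \<bar>u\<bar> > W}"
      then have "norm (F u) \<le> K * exp (- (u\<^sup>2 / (4 * pi * \<alpha> * b\<^sup>2)))" using elim by auto
      moreover have "norm (F u) = 1 / sqrt (2 * pi * b) * norm (fourier_integral g (of_real (u / b)))"
        using elim(2) by (simp only: norm_mult norm_olct_factor[OF \<open>b > 0\<close>])
      \<comment> \<open>With \<open>s = pi * \<alpha>\<close> the assumed decay of \<open>F\<close>
        in \<open>u\<close> is the critical one in the frequency \<open>u / b\<close>.\<close>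
      moreover have "u\<^sup>2 / (4 * pi * \<alpha> * b\<^sup>2) = (u / b)\<^sup>2 / (4 * s)"
        by (simp add: s_def power_divide mult_ac)
      ultimately show "norm (fourier_integral g (of_real (u / b))) \<le> ?P * exp (- ((u / b)\<^sup>2 / (4 * s)))"
        using \<open>b > 0\<close> by (simp add: pos_divide_le_eq mult_ac)
    qed
  qed
  have moment: "integrable lborel (\<lambda>t. norm (g t) * exp (k * \<bar>t\<bar>))" for k
  proof (rule Bochner_Integration.integrable_bound)
    show "integrable lborel (\<lambda>t. norm (g t) * exp (\<bar>k\<bar> * \<bar>t\<bar>))"
      by (rule gauss_decay_exp_moment(1)[OF s _ _ int decay]) (use M in auto)
  qed (auto intro!: AE_I2 mult_left_mono mult_right_mono)
  have cont: "continuous_on UNIV (fourier_integral g)"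
    by (intro holomorphic_on_imp_continuous_on holomorphic_fourier_integral moment) simp
  \<comment> \<open>The substitution \<open>u = b * \<omega>\<close> turns the threshold
    \<open>W\<close> into \<open>W / b\<close>. Continuity removes the exceptional null set, as
    Hardy's principle requires the bound at every such \<omega>.\<close>
  have decay': "norm (fourier_integral g (of_real \<omega>)) \<le> ?P * exp (- \<omega>\<^sup>2 / (4 * s))" if "\<bar>\<omega>\<bar> > W / b" for \<omega>
  proof -
    have "norm (fourier_integral g (of_real ((b * \<omega>) / b))) \<le> ?P * exp (- (((b * \<omega>) / b)\<^sup>2 / (4 * s)))"
    proof (rule AE_continuous_le_imp_le[OF _ _ _ ae])
      show "open {u. \<bar>u\<bar> > W}" by (intro open_Collect_less continuous_intros)
      show "continuous_on {u. \<bar>u\<bar> > W} (\<lambda>u. norm (fourier_integral g (of_real (u / b))))"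
        using \<open>b > 0\<close> by (intro continuous_on_norm continuous_on_compose2[OF cont] continuous_intros) auto
      show "continuous_on {u. \<bar>u\<bar> > W} (\<lambda>u. ?P * exp (- ((u / b)\<^sup>2 / (4 * s))))"
        using \<open>b > 0\<close> s by (intro continuous_intros) auto
      show "b * \<omega> \<in> {u. \<bar>u\<bar> > W}"
        using that \<open>b > 0\<close> by (simp add: abs_mult field_simps)
    qed
    then show ?thesis using \<open>b > 0\<close> by simp
  qed
  obtain C where C: "AE t in lborel. g t = C * of_real (exp (- s * t\<^sup>2))"
    using hardy_uncertainty[OF s less_imp_le[OF M(1)] int decay decay'] .
  have "AE t in lebesgue. f t = C * exp (- (complex_of_real (pi * \<alpha>) + \<i> * complex_of_real (a / (2 * b))) * complex_of_real (t\<^sup>2)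
                   - \<i> * complex_of_real (1 / b * t * \<tau>))"
    using AE_completion[OF f_g] AE_completion[OF C]
  proof eventually_elim
    case (elim t)
    \<comment> \<open>Multiplication by the inverse of the chirp recovers \<open>f\<close>.\<close>
    have "f t * olct_chirp a b \<tau> t * exp (- (\<i> * of_real (a / (2 * b) * t\<^sup>2 + 1 / b * t * \<tau>))) =
       C * (exp (of_real (- s * t\<^sup>2)) * exp (- (\<i> * of_real (a / (2 * b) * t\<^sup>2 + 1 / b * t * \<tau>))))"
      using elim by (simp only: exp_of_real mult.assoc)
    moreover have "olct_chirp a b \<tau> t * exp (- (\<i> * of_real (a / (2 * b) * t\<^sup>2 + 1 / b * t * \<tau>))) = 1"
      unfolding olct_chirp_def by (simp only: exp_add[symmetric] add.right_inverse exp_zero)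
    ultimately have "f t = C * exp (of_real (- s * t\<^sup>2) + - (\<i> * of_real (a / (2 * b) * t\<^sup>2 + 1 / b * t * \<tau>)))"
      by (simp only: exp_add mult.assoc mult_1_right)
    moreover have "of_real (- s * t\<^sup>2) + - (\<i> * of_real (a / (2 * b) * t\<^sup>2 + 1 / b * t * \<tau>)) =
      - (complex_of_real (pi * \<alpha>) + \<i> * complex_of_real (a / (2 * b))) * complex_of_real (t\<^sup>2) - \<i> * complex_of_real (1 / b * t * \<tau>)"
      by (simp add: s_def algebra_simps)
    ultimately show ?case by simp
  qed
  then show ?thesis by blast
qed

end
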